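(* Assume (H0), (H1), (H2) and Isaacs' conditions (all as stated in the context). Let $x_j\in G$ be a node such that, for some $\epsilon\in[0,\Delta x)$ and some direction $d\in B(0,1)$, the point $x=x_j-\epsilon d\in\Omega$ satisfies $v_i(x)=v(x)$ for a certain $i\in\mathcal{I}$. Then $$|V_i(x_j)-V(x_j)|\le 2\left(C(\Delta x)^q+M\Delta x\right),$$ where $C,q$ are the constants of the a priori error estimate (E) of the scheme and $M:=\max\{L_{v_i}: i\in\mathcal{I}\}$, with $L_{v_i}$ the Lipschitz constant of $v_i$.
   Context: Setting. $\Omega\subset\mathbb{R}^n$ is open; $A,B$ are compact subsets of a Euclidean space; $\mathcal{A}$ (resp. $\mathcal{B}$) is the set of measurable functions $\mathbb{R}^+\to A$ (resp. $\mathbb{R}^+\to B$). For $x\in\overline{\Omega}$, $a\in\mathcal{A}$, $b\in\mathcal{B}$, the trajectory $y_x(t,a(t),b(t))$ is the solution of $\dot y(t)=f(y(t),a(t),b(t))$ a.e., $y(0)=x$. The exit time is $\tau_x(a,b):=\min\{t\in[0,+\infty): y_x(t,a(t),b(t))\notin\Omega\}$. For $\lambda\ge 0$ the cost is $$J_x(a,b):=\int_0^{\tau_x(a,b)} l(y_x(s,a(s),b(s)),a(s),b(s))e^{-\lambda s}\,ds+e^{-\lambda\tau_x(a,b)}g(y_x(\tau_x(a,b))).$$ $\Phi$ is the set of non-anticipating strategies, i.e. maps $\phi:\mathcal{A}\to\mathcal{B}$ such that for all $t>0$, $a(s)=\tilde a(s)$ for all $s\le t$ implies $\phi[a](s)=\phi[\tilde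 a](s)$ for all $s\le t$. The value function is $v(x):=\sup_{\phi\in\Phi}\inf_{a\in\mathcal{A}}J_x(a,\phi(a))$. (H0): $f:\Omega\times A\times B\to\mathbb{R}^n$ is continuous, and Lipschitz continuous in the first variable; $l:\Omega\times A\times B\to(\rho,+\infty]$ (with $\rho>0$) is a strictly positive continuous function, Lipschitz continuous in the first variable; $g:\overline\Omega\to\mathbb{R}$ is continuous. Hamiltonian: $H(x,p):=\min_{b\in B}\max_{a\in A}\{-f(x,a,b)\cdot p-l(x,a,b)\}$. Isaacs' conditions: the $\min_b$ and the $\max_a$ in this formula can be interchanged, for all $x,p$. Under these conditions $v$ is a viscosity solution of $$\text{(HJ)}\qquad \lambda v(x)+H(x,Dv(x))=0 \ \text{ for } x\in\Omega,\qquad v(x)=g(x)\ \text{ for } x\in\Gamma,$$ where $\Gamma\subset\partial\Omega$ is an $(n-1)$-dimensional set. (H1): problem (HJ) has a unique Lipschitz continuous viscosity solution $v$. Auxiliary problems. Let $\mathcal{I}=\{1,\dots,m\}$ and $\Gamma=\bigcup_{i\in\mathcal{I}}\Gamma_i$. For each $i$ let $g_i:\Gamma\to\mathbb{R}$ be a regular function with $g_i(x)=g(x)$ if $x\in\Gamma_i$ and $g_i(x)>g(x)$ otherwise. $v_i:\overline\Omega\to\mathbb{R}$ denotes a Lipschitz continuous viscosity solution (assumed to exist) of $$\text{(HJ}_i)\qquad \lambda v_i(x)+H(x,Dv_i(x))=0\ \text{ for } x\in\Omega,\qquad v_i(x)=g_i(x)\ \text{ for } x\in\Gamma .$$ (H2):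 put $\bar v(x):=\min_{i\in\mathcal{I}}v_i(x)$, $I(x):=\{j\in\mathcal{I}: v_j(x)=\bar v(x)\}$, $\Upsilon:=\{x\in\Omega: \mathrm{Card}(I(x))>1\}$. For every $x\in\Upsilon$, every choice of $p_i\in\partial^L v_i(x)$, $i\in I(x)$, and every family of convex combination coefficients $\{\alpha_i\}_{i\in I(x)}$, $$\lambda\bar v(x)+H\Big(x,\sum_{i\in I(x)}\alpha_i p_i\Big)\le 0 .$$ Here $\partial^L w(x)$ is the limiting superdifferential: the set of $p$ for which there exist $p_k\to p$, $x_k\to x$ with $p_k\in D^+w(x_k)$ for each $k$, $D^+$ being the Fréchet superdifferential. Discretization. A structured grid is a family of simplices $S_j$ with $\overline\Omega\subseteq\bigcup_j S_j$, nodes $x_1,\dots,x_N$ and size $\Delta x:=\max_j\mathrm{diam}(S_j)$. $G$ denotes the set of internal nodes, $\partial G$ the set of boundary nodes, and (for bounded $\Omega$) the nodes in $\mathbb{R}^n\setminus\overline\Omega$ are called ghost nodes. For a vector $V=(V(1),\dots,V(N))$ of nodal values (also written $V(x_j)=V(j)$), $\mathbb{I}[V]$ is its piecewise linear interpolation. With a fictitious time step $h>0$ (chosen in dependence on $\Delta x$), the semi-Lagrangian scheme for (HJ) is the fixed point equation $V=T(V)$ with $$[T(V)]_k=\begin{cases}\max_{b\in B}\min_{a\in A}\left\{\frac{1}{1+\lambda h}\mathbb{I}[V](x_k+hf(x_k,a,b))+h\,l(x_k,a,b)\right\}& x_k\in G,\\ g(x_k)& x_k\in\partial G,\\ +\infty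 & x_k\text{ ghost node.}\end{cases}$$ $V$ denotes the solution of this scheme, and $V_i$ the solution of the same scheme for (HJ$_i$), i.e. with $g$ replaced by $g_i$. $B(x,r)$ denotes the $n$-dimensional ball of centre $x$ and radius $r$. A priori error estimate (E) of the scheme: there are $C>0$ independent of $\Delta x$ and $q\in\mathbb{R}^+$ (depending on the regularity of the problem) with $\|v-V\|_\infty\le C(\Delta x)^q$ and $\|v_i-V_i\|_\infty\le C(\Delta x)^q$ for all $i\in\mathcal{I}$. *)

theory Defs
  imports "HOL-Analysis.Analysis"
begin

subsection \<open>Controls, trajectories and the value function\<close>

text \<open>Controls live on the half line; their values at negative times play no role.\<close>

definition controls :: "'b::euclidean_space set \<Rightarrow> (real \<Rightarrow> 'b) set" where
  "controls A = {\<alpha>. \<alpha> \<in> borel_measurable (lebesgue_on {0..}) \<and> (\<forall>t\<ge>0. \<alpha> t \<in> A)}"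

definition nonanticipating ::
  "'b::euclidean_space set \<Rightarrow> 'c::euclidean_space set \<Rightarrow> ((real \<Rightarrow> 'b) \<Rightarrow> (real \<Rightarrow> 'c)) set" where
  "nonanticipating A B =
    {\<phi>. (\<forall>\<alpha>\<in>controls A. \<phi> \<alpha> \<in> controls B) \<and>
        (\<forall>t>0. \<forall>\<alpha>\<in>controls A. \<forall>\<alpha>'\<in>controls A.
           (\<forall>s\<in>{0..t}. \<alpha> s = \<alpha>' s) \<longrightarrow> (\<forall>s\<in>{0..t}. \<phi> \<alpha> s = \<phi> \<alpha>' s))}"

definition abs_continuous_on :: "real set \<Rightarrow> (real \<Rightarrow> 'a::euclidean_space) \<Rightarrow> bool" where
  "abs_continuous_on S y \<longleftrightarrow>
    (\<forall>\<epsilon>>0. \<exists>\<delta>>0. \<forall>d t. d division_of t \<and> t \<subseteq> S \<and> (\<Sum>k\<in>d. Sup k - Inf k) < \<delta> \<longrightarrow>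
       (\<Sum>k\<in>d. norm (y (Sup k) - y (Inf k))) < \<epsilon>)"

text \<open>The dynamics \<open>f\<close> is only given on \<open>\<Omega>\<close>, so the differential equation is imposed as long
  as the curve has not left \<open>\<Omega>\<close>. If \<open>f\<close> is continuous and uniformly Lipschitz in the state, such
  a curve exists and is unique up to and including its exit time; what it does afterwards is
  arbitrary and is never used.\<close>

definition is_trajectory ::
  "'a::euclidean_space set \<Rightarrow> ('a \<Rightarrow> 'b \<Rightarrow> 'c \<Rightarrow> 'a) \<Rightarrow> 'a \<Rightarrow> (real \<Rightarrow> 'b) \<Rightarrow> (real \<Rightarrow> 'c)
    \<Rightarrow> (real \<Rightarrow> 'a) \<Rightarrow> bool" where
  "is_trajectory \<Omega> f x \<alpha> \<beta> y \<longleftrightarrow>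
    y 0 = x \<and> (\<forall>T\<ge>0. abs_continuous_on {0..T} y) \<and>
    (AE t in lebesgue. 0 \<le> t \<and> (\<forall>s\<in>{0..t}. y s \<in> \<Omega>) \<longrightarrow>
       (y has_vector_derivative f (y t) (\<alpha> t) (\<beta> t)) (at t))"

definition trajectory ::
  "'a::euclidean_space set \<Rightarrow> ('a \<Rightarrow> 'b \<Rightarrow> 'c \<Rightarrow> 'a) \<Rightarrow> 'a \<Rightarrow> (real \<Rightarrow> 'b) \<Rightarrow> (real \<Rightarrow> 'c)
    \<Rightarrow> real \<Rightarrow> 'a" where
  "trajectory \<Omega> f x \<alpha> \<beta> = (SOME y. is_trajectory \<Omega> f x \<alpha> \<beta> y)"

text \<open>\<open>\<infinity>\<close> if the curve never leaves \<open>\<Omega>\<close>; otherwise the infimum is a minimum, \<open>\<Omega>\<close> being open.\<close>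

definition exit_time :: "'a::euclidean_space set \<Rightarrow> (real \<Rightarrow> 'a) \<Rightarrow> ereal" where
  "exit_time \<Omega> y = Inf (ereal ` {t. 0 \<le> t \<and> y t \<notin> \<Omega>})"

text \<open>The running cost is positive, so its integral is a nonnegative, possibly infinite, Lebesgue
  integral. There is no exit cost when the exit time is infinite.\<close>

definition cost ::
  "'a::euclidean_space set \<Rightarrow> ('a \<Rightarrow> 'b \<Rightarrow> 'c \<Rightarrow> 'a) \<Rightarrow> ('a \<Rightarrow> 'b \<Rightarrow> 'c \<Rightarrow> ereal) \<Rightarrow> ('a \<Rightarrow> real)
    \<Rightarrow> real \<Rightarrow> 'a \<Rightarrow> (real \<Rightarrow> 'b) \<Rightarrow> (real \<Rightarrow> 'c) \<Rightarrow> ereal" where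
  "cost \<Omega> f l g lam x \<alpha> \<beta> =
    (let y = trajectory \<Omega> f x \<alpha> \<beta>; \<tau> = exit_time \<Omega> y in
     enn2ereal (\<integral>\<^sup>+ s. e2ennreal (l (y s) (\<alpha> s) (\<beta> s)) * ennreal (exp (- lam * s))
                    * indicator {s. 0 \<le> s \<and> ereal s < \<tau>} s \<partial>lebesgue)
     + (if \<tau> = \<infinity> then 0
        else ereal (exp (- lam * real_of_ereal \<tau>) * g (y (real_of_ereal \<tau>)))))"

definition value_function ::
  "'a::euclidean_space set \<Rightarrow> 'b::euclidean_space set \<Rightarrow> 'c::euclidean_space set
    \<Rightarrow> ('a \<Rightarrow> 'b \<Rightarrow> 'c \<Rightarrow> 'a) \<Rightarrow> ('a \<Rightarrow> 'b \<Rightarrow> 'c \<Rightarrow> ereal) \<Rightarrow> ('a \<Rightarrow> real) \<Rightarrow> real \<Rightarrow> 'a \<Rightarrow> ereal" where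
  "value_function \<Omega> A B f l g lam x =
    (SUP \<phi>\<in>nonanticipating A B. INF \<alpha>\<in>controls A. cost \<Omega> f l g lam x \<alpha> (\<phi> \<alpha>))"

subsection \<open>Standing assumptions on the data, Hamiltonian\<close>

text \<open>For the extended-valued \<open>l\<close> the one-sided Lipschitz inequality (for all ordered pairs) says
  that, for fixed controls, \<open>l\<close> is either Lipschitz and finite or identically \<open>\<infinity>\<close>.\<close>

definition H0 ::
  "'a::euclidean_space set \<Rightarrow> 'b::euclidean_space set \<Rightarrow> 'c::euclidean_space set
    \<Rightarrow> ('a \<Rightarrow> 'b \<Rightarrow> 'c \<Rightarrow> 'a) \<Rightarrow> ('a \<Rightarrow> 'b \<Rightarrow> 'c \<Rightarrow> ereal) \<Rightarrow> ('a \<Rightarrow> real) \<Rightarrow> real \<Rightarrow> bool" where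
  "H0 \<Omega> A B f l g \<rho> \<longleftrightarrow>
    continuous_on (\<Omega> \<times> A \<times> B) (\<lambda>(x, a, b). f x a b) \<and>
    (\<exists>L. \<forall>a\<in>A. \<forall>b\<in>B. L-lipschitz_on \<Omega> (\<lambda>x. f x a b)) \<and>
    0 < \<rho> \<and> (\<forall>x\<in>\<Omega>. \<forall>a\<in>A. \<forall>b\<in>B. ereal \<rho> < l x a b) \<and>
    continuous_on (\<Omega> \<times> A \<times> B) (\<lambda>(x, a, b). l x a b) \<and>
    (\<exists>L\<ge>0. \<forall>a\<in>A. \<forall>b\<in>B. \<forall>x\<in>\<Omega>. \<forall>y\<in>\<Omega>. l x a b \<le> l y a b + ereal (L * dist x y)) \<and>
    continuous_on (closure \<Omega>) g"

definition hamiltonian ::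
  "'b::euclidean_space set \<Rightarrow> 'c::euclidean_space set \<Rightarrow> ('a::euclidean_space \<Rightarrow> 'b \<Rightarrow> 'c \<Rightarrow> 'a)
    \<Rightarrow> ('a \<Rightarrow> 'b \<Rightarrow> 'c \<Rightarrow> ereal) \<Rightarrow> 'a \<Rightarrow> 'a \<Rightarrow> ereal" where
  "hamiltonian A B f l x p = (INF b\<in>B. SUP a\<in>A. ereal (- (f x a b \<bullet> p)) - l x a b)"

definition isaacs ::
  "'a::euclidean_space set \<Rightarrow> 'b::euclidean_space set \<Rightarrow> 'c::euclidean_space set
    \<Rightarrow> ('a \<Rightarrow> 'b \<Rightarrow> 'c \<Rightarrow> 'a) \<Rightarrow> ('a \<Rightarrow> 'b \<Rightarrow> 'c \<Rightarrow> ereal) \<Rightarrow> bool" where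
  "isaacs \<Omega> A B f l \<longleftrightarrow>
    (\<forall>x\<in>\<Omega>. \<forall>p. (INF b\<in>B. SUP a\<in>A. ereal (- (f x a b \<bullet> p)) - l x a b)
               = (SUP a\<in>A. INF b\<in>B. ereal (- (f x a b \<bullet> p)) - l x a b))"

text \<open>Hausdorff dimension. For \<open>s > 0\<close>, the \<open>s\<close>-dimensional Hausdorff measure of \<open>S\<close> vanishes
  iff \<open>S\<close> has countable covers with arbitrarily small \<open>s\<close>-dimensional diameter sum; small sums
  force small diameters.\<close>

definition hausdorff_null :: "real \<Rightarrow> 'a::euclidean_space set \<Rightarrow> bool" where
  "hausdorff_null s S \<longleftrightarrow>
    (\<forall>\<epsilon>>0. \<exists>U :: nat \<Rightarrow> 'a set. S \<subseteq> (\<Union>k. U k) \<and> (\<forall>k. bounded (U k)) \<and>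
       summable (\<lambda>k. diameter (U k) powr s) \<and> (\<Sum>k. diameter (U k) powr s) < \<epsilon>)"

definition hausdorff_dim :: "'a::euclidean_space set \<Rightarrow> real" where
  "hausdorff_dim S = Inf {s. 0 < s \<and> hausdorff_null s S}"

subsection \<open>Viscosity solutions\<close>

definition C1_gradient :: "'a::euclidean_space set \<Rightarrow> ('a \<Rightarrow> real) \<Rightarrow> ('a \<Rightarrow> 'a) \<Rightarrow> bool" where
  "C1_gradient \<Omega> \<phi> D\<phi> \<longleftrightarrow> (\<forall>x\<in>\<Omega>. GDERIV \<phi> x :> D\<phi> x) \<and> continuous_on \<Omega> D\<phi>"

definition viscosity_solution ::
  "'a::euclidean_space set \<Rightarrow> real \<Rightarrow> ('a \<Rightarrow> 'a \<Rightarrow> ereal) \<Rightarrow> ('a \<Rightarrow> real) \<Rightarrow> bool" where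
  "viscosity_solution \<Omega> lam H w \<longleftrightarrow>
    continuous_on \<Omega> w \<and>
    (\<forall>\<phi> D\<phi> x. C1_gradient \<Omega> \<phi> D\<phi> \<and> x \<in> \<Omega> \<and>
       (\<forall>\<^sub>F y in nhds x. w y - \<phi> y \<le> w x - \<phi> x) \<longrightarrow> ereal (lam * w x) + H x (D\<phi> x) \<le> 0) \<and>
    (\<forall>\<phi> D\<phi> x. C1_gradient \<Omega> \<phi> D\<phi> \<and> x \<in> \<Omega> \<and>
       (\<forall>\<^sub>F y in nhds x. w y - \<phi> y \<ge> w x - \<phi> x) \<longrightarrow> ereal (lam * w x) + H x (D\<phi> x) \<ge> 0)"

definition lipschitz_solution ::
  "'a::euclidean_space set \<Rightarrow> 'a set \<Rightarrow> real \<Rightarrow> ('a \<Rightarrow> 'a \<Rightarrow> ereal) \<Rightarrow> ('a \<Rightarrow> real) \<Rightarrow> ('a \<Rightarrow> real)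
    \<Rightarrow> bool" where
  "lipschitz_solution \<Omega> \<Gamma> lam H g w \<longleftrightarrow>
    (\<exists>L. L-lipschitz_on (closure \<Omega>) w) \<and> viscosity_solution \<Omega> lam H w \<and> (\<forall>x\<in>\<Gamma>. w x = g x)"

definition unique_lipschitz_solution ::
  "'a::euclidean_space set \<Rightarrow> 'a set \<Rightarrow> real \<Rightarrow> ('a \<Rightarrow> 'a \<Rightarrow> ereal) \<Rightarrow> ('a \<Rightarrow> real) \<Rightarrow> ('a \<Rightarrow> real)
    \<Rightarrow> bool" where
  "unique_lipschitz_solution \<Omega> \<Gamma> lam H g v \<longleftrightarrow>
    lipschitz_solution \<Omega> \<Gamma> lam H g v \<and>
    (\<forall>w. lipschitz_solution \<Omega> \<Gamma> lam H g w \<longrightarrow> (\<forall>x\<in>closure \<Omega>. w x = v x))"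

definition lip_const :: "'a::euclidean_space set \<Rightarrow> ('a \<Rightarrow> real) \<Rightarrow> real" where
  "lip_const S w = Inf {L. L-lipschitz_on S w}"

subsection \<open>Superdifferentials and the condition on the auxiliary solutions\<close>

definition frechet_superdiff :: "'a::euclidean_space set \<Rightarrow> ('a \<Rightarrow> real) \<Rightarrow> 'a \<Rightarrow> 'a set" where
  "frechet_superdiff \<Omega> w x =
    {p. Limsup (at x within \<Omega>) (\<lambda>y. ereal ((w y - w x - p \<bullet> (y - x)) / norm (y - x))) \<le> 0}"

definition limiting_superdiff :: "'a::euclidean_space set \<Rightarrow> ('a \<Rightarrow> real) \<Rightarrow> 'a \<Rightarrow> 'a set" where
  "limiting_superdiff \<Omega> w x =
    {p. \<exists>X P. (\<forall>k::nat. X k \<in> \<Omega> \<and> P k \<in> frechet_superdiff \<Omega> w (X k)) \<and>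
              X \<longlonglongrightarrow> x \<and> P \<longlonglongrightarrow> p}"

definition min_value :: "nat \<Rightarrow> (nat \<Rightarrow> 'a \<Rightarrow> real) \<Rightarrow> 'a \<Rightarrow> real" where
  "min_value m vi x = Min ((\<lambda>i. vi i x) ` {1..m})"

definition active :: "nat \<Rightarrow> (nat \<Rightarrow> 'a \<Rightarrow> real) \<Rightarrow> 'a \<Rightarrow> nat set" where
  "active m vi x = {j \<in> {1..m}. vi j x = min_value m vi x}"

definition H2 ::
  "'a::euclidean_space set \<Rightarrow> real \<Rightarrow> ('a \<Rightarrow> 'a \<Rightarrow> ereal) \<Rightarrow> nat \<Rightarrow> (nat \<Rightarrow> 'a \<Rightarrow> real) \<Rightarrow> bool" where
  "H2 \<Omega> lam H m vi \<longleftrightarrow>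
    (\<forall>x\<in>\<Omega>. card (active m vi x) > 1 \<longrightarrow>
      (\<forall>p \<alpha>. (\<forall>i\<in>active m vi x. p i \<in> limiting_superdiff \<Omega> (vi i) x) \<and>
             (\<forall>i\<in>active m vi x. 0 \<le> \<alpha> i) \<and> (\<Sum>i\<in>active m vi x. \<alpha> i) = 1 \<longrightarrow>
        ereal (lam * min_value m vi x) + H x (\<Sum>i\<in>active m vi x. \<alpha> i *\<^sub>R p i) \<le> 0))"

subsection \<open>Grids and the semi-Lagrangian scheme\<close>

definition vertices :: "'a::euclidean_space set \<Rightarrow> 'a set" where
  "vertices T = {z. z extreme_point_of T}"

definition nodes :: "'a::euclidean_space set set \<Rightarrow> 'a set" where
  "nodes \<T> = (\<Union>T\<in>\<T>. vertices T)"

definition is_grid :: "'a::euclidean_space set \<Rightarrow> 'a set set \<Rightarrow> bool" where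
  "is_grid \<Omega> \<T> \<longleftrightarrow> triangulation \<T> \<and> closure \<Omega> \<subseteq> \<Union>\<T>"

definition mesh_size :: "'a::euclidean_space set set \<Rightarrow> real" where
  "mesh_size \<T> = Max (diameter ` \<T>)"

definition internal_nodes :: "'a::euclidean_space set \<Rightarrow> 'a set set \<Rightarrow> 'a set" where
  "internal_nodes \<Omega> \<T> = nodes \<T> \<inter> \<Omega>"

definition boundary_nodes :: "'a::euclidean_space set \<Rightarrow> 'a set set \<Rightarrow> 'a set" where
  "boundary_nodes \<Omega> \<T> = nodes \<T> \<inter> frontier \<Omega>"

text \<open>Piecewise linear interpolation through barycentric coordinates. The value does not depend on
  the simplex chosen, since simplices of a triangulation meet in common faces and \<open>0 * \<infinity> = 0\<close> in
  \<^typ>\<open>ereal\<close>. A simplex with a ghost vertex of positive weight yields \<open>\<infinity>\<close>; points not covered by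
  the grid are treated in the same way.\<close>

definition interpolation :: "'a::euclidean_space set set \<Rightarrow> ('a \<Rightarrow> ereal) \<Rightarrow> 'a \<Rightarrow> ereal" where
  "interpolation \<T> V x =
    (if x \<in> \<Union>\<T> then
       (THE r. \<exists>T\<in>\<T>. \<exists>u. (\<forall>z\<in>vertices T. 0 \<le> u z) \<and> (\<Sum>z\<in>vertices T. u z) = 1 \<and>
                 (\<Sum>z\<in>vertices T. u z *\<^sub>R z) = x \<and> r = (\<Sum>z\<in>vertices T. ereal (u z) * V z))
     else \<infinity>)"

definition scheme ::
  "'a::euclidean_space set \<Rightarrow> 'b::euclidean_space set \<Rightarrow> 'c::euclidean_space set
    \<Rightarrow> ('a \<Rightarrow> 'b \<Rightarrow> 'c \<Rightarrow> 'a) \<Rightarrow> ('a \<Rightarrow> 'b \<Rightarrow> 'c \<Rightarrow> ereal) \<Rightarrow> real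
    \<Rightarrow> 'a set set \<Rightarrow> real \<Rightarrow> ('a \<Rightarrow> real) \<Rightarrow> ('a \<Rightarrow> ereal) \<Rightarrow> 'a \<Rightarrow> ereal" where
  "scheme \<Omega> A B f l lam \<T> h g V x =
    (if x \<in> internal_nodes \<Omega> \<T> then
       (SUP b\<in>B. INF a\<in>A.
          ereal (1 / (1 + lam * h)) * interpolation \<T> V (x + h *\<^sub>R f x a b) + ereal h * l x a b)
     else if x \<in> boundary_nodes \<Omega> \<T> then ereal (g x)
     else \<infinity>)"

definition scheme_solution ::
  "'a::euclidean_space set \<Rightarrow> 'b::euclidean_space set \<Rightarrow> 'c::euclidean_space set
    \<Rightarrow> ('a \<Rightarrow> 'b \<Rightarrow> 'c \<Rightarrow> 'a) \<Rightarrow> ('a \<Rightarrow> 'b \<Rightarrow> 'c \<Rightarrow> ereal) \<Rightarrow> real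
    \<Rightarrow> 'a set set \<Rightarrow> real \<Rightarrow> ('a \<Rightarrow> real) \<Rightarrow> ('a \<Rightarrow> ereal) \<Rightarrow> bool" where
  "scheme_solution \<Omega> A B f l lam \<T> h g V \<longleftrightarrow>
    (\<forall>x\<in>nodes \<T>. V x \<noteq> -\<infinity> \<and> V x = scheme \<Omega> A B f l lam \<T> h g V x)"

text \<open>Ghost nodes are excluded: the continuous solution is not defined there.\<close>

definition sup_error ::
  "'a::euclidean_space set \<Rightarrow> 'a set set \<Rightarrow> ('a \<Rightarrow> real) \<Rightarrow> ('a \<Rightarrow> ereal) \<Rightarrow> ereal" where
  "sup_error \<Omega> \<T> w W = (SUP x\<in>nodes \<T> \<inter> closure \<Omega>. \<bar>ereal (w x) - W x\<bar>)"

end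

(* The proof compares V_i(x_j) with v_i(x_j), v_i(x) = v(x), v(x_j) and V(x_j), so all that is
   needed is that v itself is M-Lipschitz. This holds because v = min_i v_i: by uniqueness it is
   enough that the minimum is a viscosity solution with boundary datum g. The supersolution property
   is inherited from any active v_i. For the subsolution property at a point x where several v_i are
   active, H2 applies once the gradient of a test function touching the minimum from above is written
   as a convex combination of limiting supergradients of the active v_i. Such a combination is the
   limit of first-order conditions for maximisers (y, z) of
     -(1/k) ln (sum_i exp (-k v_i(z_i))) - (k/2) sum_i |z_i - y|^2 - phi(y) - |y - x|^2,
   where the soft minimum is smooth in each value v_i(z_i) and its partial derivatives are the
   weights. *)
theory Submission
  imports Defs
begin

section \<open>Least Lipschitz constants and Frechet superdifferentials\<close>

lemma lipschitz_on_lip_const: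
  assumes "L-lipschitz_on S w"
  shows "(lip_const S w)-lipschitz_on S w"
proof (rule lipschitz_onI)
  have ne: "{L. L-lipschitz_on S w} \<noteq> {}" using assms by auto
  show "0 \<le> lip_const S w"
    unfolding lip_const_def by (rule cInf_greatest[OF ne]) (auto dest: lipschitz_on_nonneg)
  fix x y assume xy: "x \<in> S" "y \<in> S"
  show "dist (w x) (w y) \<le> lip_const S w * dist x y"
  proof (cases "x = y")
    case False
    \<comment> \<open>The difference quotient is a lower bound for all Lipschitz constants, hence
      for their infimum, so the infimum is attained.\<close>
    then have "dist (w x) (w y) / dist x y \<le> lip_const S w"
      unfolding lip_const_def
      by (intro cInf_greatest[OF ne]) (auto simp: divide_le_eq dest: lipschitz_onD[OF _ xy])
    then show ?thesis using False by (simp add: divide_le_eq)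
  qed simp
qed

text \<open>Multiplying the quotient out leaves an inequality that is trivial at
  \<open>y = x\<close>, so the punctured filter \<open>at x\<close> may be replaced by
  \<open>nhds x\<close>.\<close>

lemma frechet_superdiff_iff:
  assumes "open \<Omega>" "x \<in> \<Omega>"
  shows "p \<in> frechet_superdiff \<Omega> w x \<longleftrightarrow>
    (\<forall>e>0. \<forall>\<^sub>F y in nhds x. w y - w x - p \<bullet> (y - x) \<le> e * norm (y - x))"
proof -
  have at: "at x within \<Omega> = at x" using assms by (intro at_within_open)
  have *: "(\<forall>\<^sub>F y in nhds x. w y - w x - p \<bullet> (y - x) \<le> e * norm (y - x)) \<longleftrightarrow>
     (\<forall>\<^sub>F y in at x. (w y - w x - p \<bullet> (y - x)) / norm (y - x) \<le> e)" for e
    unfolding eventually_at_filter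
    by (rule arg_cong[where f = "\<lambda>P. eventually P (nhds x)"]) (auto simp: fun_eq_iff divide_le_eq)
  show ?thesis
    unfolding frechet_superdiff_def mem_Collect_eq at Limsup_le_iff *
  proof (intro iffI allI impI)
    fix e :: real
    assume H: "\<forall>y>0. \<forall>\<^sub>F z in at x. ereal ((w z - w x - p \<bullet> (z - x)) / norm (z - x)) < y" "e > 0"
    then have "\<forall>\<^sub>F z in at x. ereal ((w z - w x - p \<bullet> (z - x)) / norm (z - x)) < ereal e"
      by (intro H(1)[rule_format]) simp
    then show "\<forall>\<^sub>F z in at x. (w z - w x - p \<bullet> (z - x)) / norm (z - x) \<le> e"
      by eventually_elim simp
  next
    fix c :: ereal
    assume H: "\<forall>e>0. \<forall>\<^sub>F z in at x. (w z - w x - p \<bullet> (z - x)) / norm (z - x) \<le> e" "c > 0"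
    then obtain e where e: "0 < ereal e" "ereal e < c" using ereal_dense2[of 0 c] by blast
    then have "\<forall>\<^sub>F z in at x. (w z - w x - p \<bullet> (z - x)) / norm (z - x) \<le> e" using H by simp
    then show "\<forall>\<^sub>F z in at x. ereal ((w z - w x - p \<bullet> (z - x)) / norm (z - x)) < c"
      by eventually_elim (use e(2) le_less_trans[OF _ e(2)] in simp)
  qed
qed

lemma eventually_nhds_has_derivative_error:
  fixes F :: "'a::real_normed_vector \<Rightarrow> real"
  assumes "(F has_derivative F') (at x)" "e > 0"
  shows "\<forall>\<^sub>F y in nhds x. \<bar>F y - F x - F' (y - x)\<bar> \<le> e * norm (y - x)"
  using assms unfolding has_derivative_at_alt eventually_nhds_metric
  by (metis dist_norm real_norm_def)

text \<open>Chain rule for a nonsmooth \<open>w\<close>: the increment of \<open>F (w y)\<close> is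
  \<open>s * (w y - w x)\<close> up to an error that the Lipschitz bound makes small against
  \<open>norm (y - x)\<close>. Dividing by \<open>s > 0\<close> keeps the direction of the
  inequality.\<close>

lemma frechet_superdiff_of_max:
  assumes "open \<Omega>" "x \<in> \<Omega>" and lip: "L-lipschitz_on \<Omega> w"
    and F: "(F has_real_derivative s) (at (w x))" and s: "s > 0"
    and q: "GDERIV q x :> p"
    and max: "\<forall>\<^sub>F y in nhds x. F (w y) - q y \<le> F (w x) - q x"
  shows "(1 / s) *\<^sub>R p \<in> frechet_superdiff \<Omega> w x"
  unfolding frechet_superdiff_iff[OF assms(1,2)]
proof (intro allI impI)
  fix e :: real assume e: "e > 0"
  have L: "0 \<le> L" using lip by (rule lipschitz_on_nonneg)
  \<comment> \<open>The expansions of \<open>F\<close> and \<open>q\<close> contribute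
    \<open>e' * L\<close> and \<open>e'\<close>; together they are \<open>e * s\<close>, which
    division by \<open>s\<close> turns into \<open>e\<close>. The summand 1 keeps the denominator
    positive when \<open>L = 0\<close>.\<close>
  define e' where "e' = e * s / (L + 1)"
  have e': "e' > 0" using e s L by (auto simp: e'_def)
  have "\<forall>\<^sub>F t in nhds (w x). \<bar>F t - F (w x) - s * (t - w x)\<bar> \<le> e' * norm (t - w x)"
    using eventually_nhds_has_derivative_error[OF _ e'] F
    unfolding has_field_derivative_def by blast
  moreover have "filterlim w (nhds (w x)) (nhds x)"
    using continuous_on_interior[OF lipschitz_on_continuous_on[OF lip]] assms(1,2)
    by (simp add: interior_open isCont_def tendsto_at_iff_tendsto_nhds)
  ultimately have "\<forall>\<^sub>F y in nhds x. \<bar>F (w y) - F (w x) - s * (w y - w x)\<bar> \<le> e' * norm (w y - w x)"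
    by (rule eventually_compose_filterlim)
  moreover have "\<forall>\<^sub>F y in nhds x. \<bar>q y - q x - inner (y - x) p\<bar> \<le> e' * norm (y - x)"
    using eventually_nhds_has_derivative_error[OF _ e'] q unfolding gderiv_def by blast
  moreover have "\<forall>\<^sub>F y in nhds x. y \<in> \<Omega>" using assms(1,2) by (rule eventually_nhds_in_open)
  ultimately show "\<forall>\<^sub>F y in nhds x. w y - w x - (1 / s) *\<^sub>R p \<bullet> (y - x) \<le> e * norm (y - x)"
    using max
  proof eventually_elim
    case (elim y)
    have "norm (w y - w x) \<le> L * norm (y - x)"
      using lipschitz_on_normD[OF lip] elim assms(2) by blast
    then have "e' * norm (w y - w x) \<le> e' * (L * norm (y - x))"
      using e' by (intro mult_left_mono) auto
    then have "s * (w y - w x) \<le> p \<bullet> (y - x) + e' * (L + 1) * norm (y - x)"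
      using elim by (simp add: inner_commute algebra_simps abs_le_iff)
    also have "e' * (L + 1) = e * s" using L by (simp add: e'_def)
    finally have "w y - w x \<le> (p \<bullet> (y - x) + e * s * norm (y - x)) / s"
      using s by (simp add: le_divide_eq mult.commute)
    also have "\<dots> = (1 / s) * (p \<bullet> (y - x)) + e * norm (y - x)" using s by (simp add: add_divide_distrib)
    finally show ?case by simp
  qed
qed

text \<open>A step from \<open>x\<close> along \<open>-p\<close> forces \<open>w\<close> to fall at
  a rate of nearly \<open>norm p\<close>, which a Lipschitz function allows only up to
  \<open>L\<close>. This supplies the compactness for the later passage to the limit.\<close>

lemma norm_frechet_superdiff_le:
  assumes "open \<Omega>" "x \<in> \<Omega>" and lip: "L-lipschitz_on \<Omega> w"
    and p: "p \<in> frechet_superdiff \<Omega> w x"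
  shows "norm p \<le> L"
proof (rule field_le_epsilon)
  fix e :: real assume e: "e > 0"
  show "norm p \<le> L + e"
  proof (cases "p = 0")
    case True then show ?thesis using lipschitz_on_nonneg[OF lip] e by simp
  next
    case False
    have "\<forall>\<^sub>F y in nhds x. y \<in> \<Omega> \<and> w y - w x - p \<bullet> (y - x) \<le> e * norm (y - x)"
      using p e eventually_nhds_in_open[OF assms(1,2)]
      unfolding frechet_superdiff_iff[OF assms(1,2)] by (auto intro: eventually_conj)
    then obtain d where d: "d > 0"
      "\<And>y. dist y x < d \<Longrightarrow> y \<in> \<Omega> \<and> w y - w x - p \<bullet> (y - x) \<le> e * norm (y - x)"
      unfolding eventually_nhds_metric by blast
    \<comment> \<open>With this \<open>t\<close> the point \<open>y\<close> lies at distance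
      \<open>d / 2\<close> from \<open>x\<close>.\<close>
    define t where "t = d / (2 * norm p)"
    have t: "t > 0" using d False by (simp add: t_def)
    define y where "y = x - t *\<^sub>R p"
    have n: "norm (y - x) = t * norm p" using t by (simp add: y_def)
    have "dist y x < d" using n False d by (simp add: dist_norm t_def)
    then have y: "y \<in> \<Omega>" "w y - w x - p \<bullet> (y - x) \<le> e * norm (y - x)" using d by auto
    have "norm (w y - w x) \<le> L * norm (y - x)"
      using lipschitz_on_normD[OF lip] y assms(2) by blast
    moreover have "p \<bullet> (y - x) = - t * (norm p * norm p)"
      by (simp add: y_def power2_norm_eq_inner[symmetric] power2_eq_square)
    ultimately have "t * (norm p * norm p) \<le> (L + e) * (t * norm p)"
      using y n by (simp add: algebra_simps abs_le_iff)
    then have "(t * norm p) * norm p \<le> (t * norm p) * (L + e)" by (simp add: algebra_simps)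
    then show ?thesis using t False by (simp add: mult_le_cancel_left_pos)
  qed
qed

section \<open>Soft minimum, penalised maximisation and the convex combination of
  supergradients\<close>

lemma compact_PiE_UNIV:
  fixes S :: "'i \<Rightarrow> 'b::topological_space set"
  assumes "\<And>i. compact (S i)"
  shows "compact (PiE UNIV S)"
  using assms compactin_PiE[of "\<lambda>_. euclidean" UNIV S]
  by (simp add: euclidean_product_topology)

text \<open>A sum of positive terms lies between its largest term and \<open>card I\<close> times
  that term; here the largest one belongs to the minimal \<open>t i\<close>.\<close>

lemma softmin_bounds:
  fixes t :: "'i \<Rightarrow> real"
  assumes "finite I" "I \<noteq> {}" "k > 0"
  shows "- (1 / k) * ln (\<Sum>i\<in>I. exp (- k * t i)) \<le> Min (t ` I)"
    and "Min (t ` I) - ln (real (card I)) / k \<le> - (1 / k) * ln (\<Sum>i\<in>I. exp (- k * t i))"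
proof -
  let ?E = "\<Sum>i\<in>I. exp (- k * t i)"
  have pos: "?E > 0" using assms by (intro sum_pos) auto
  have c: "card I > 0" using assms by (simp add: card_gt_0_iff)
  have "exp (- k * t i) \<le> ?E" if "i \<in> I" for i
    using that assms by (intro member_le_sum) auto
  then have "- k * t i \<le> ln ?E" if "i \<in> I" for i
    using that pos by (simp add: ln_ge_iff)
  then have "- (1 / k) * ln ?E \<le> t i" if "i \<in> I" for i
    using that assms by (fastforce simp: field_simps)
  then show "- (1 / k) * ln ?E \<le> Min (t ` I)" using assms by simp
  have "?E \<le> of_nat (card I) * exp (- k * Min (t ` I))"
    using assms by (intro sum_bounded_above) (auto simp: mult_le_cancel_left_pos)
  then have "ln ?E \<le> ln (real (card I) * exp (- k * Min (t ` I)))"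
    using pos c by (subst ln_le_cancel_iff) auto
  also have "\<dots> = ln (real (card I)) - k * Min (t ` I)" using c by (simp add: ln_mult)
  finally have "ln ?E / k \<le> (ln (real (card I)) - k * Min (t ` I)) / k"
    using assms by (intro divide_right_mono) auto
  then show "Min (t ` I) - ln (real (card I)) / k \<le> - (1 / k) * ln ?E"
    using assms by (simp add: diff_divide_distrib)
qed

text \<open>One stage of the limit, inside a ball of radius \<open>r\<close>. Each index has its own
  copy \<open>z i\<close> of the variable, so that maximality in \<open>z i\<close> involves
  \<open>u i\<close> alone, while \<open>y\<close> enters only through \<open>\<phi>\<close> and the
  quadratic penalties.\<close>

lemma approximate_superdiff_Min:
  fixes u :: "'i::countable \<Rightarrow> 'a::euclidean_space \<Rightarrow> real"
  assumes \<Omega>: "open \<Omega>" "cball x r \<subseteq> \<Omega>" "r > 0" and I: "finite I" "I \<noteq> {}"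
    and lip: "\<And>i. i \<in> I \<Longrightarrow> L-lipschitz_on \<Omega> (u i)"
    and eq: "\<And>i. i \<in> I \<Longrightarrow> u i x = c"
    and \<phi>: "C1_gradient \<Omega> \<phi> D\<phi>"
    and max: "\<And>y. y \<in> cball x r \<Longrightarrow> Min ((\<lambda>i. u i y) ` I) - \<phi> y \<le> c - \<phi> x"
  obtains y z \<sigma> p where "y \<in> ball x r"
    and "\<And>i. i \<in> I \<Longrightarrow> z i \<in> ball x r"
    and "\<And>i. i \<in> I \<Longrightarrow> 0 < \<sigma> i" and "sum \<sigma> I = 1"
    and "\<And>i. i \<in> I \<Longrightarrow> p i \<in> frechet_superdiff \<Omega> (u i) (z i)"
    and "(\<Sum>i\<in>I. \<sigma> i *\<^sub>R p i) = D\<phi> y + 2 *\<^sub>R (y - x)"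
proof -
  obtain i0 where i0: "i0 \<in> I" using I by blast
  have L: "0 \<le> L" using lipschitz_on_nonneg[OF lip[OF i0]] .
  define n where "n = real (card I)"
  have n: "n \<ge> 1" using I by (simp add: n_def Suc_le_eq card_gt_0_iff)
  \<comment> \<open>\<open>K / k\<close> will bound
    \<open>(norm (y - x))\<^sup>2 + k / 4 * P y z\<close>: \<open>ln n\<close> is the loss of the
    soft minimum, \<open>n * L\<^sup>2\<close> comes from Young's inequality. The choice of
    \<open>k\<close> makes this bound smaller than \<open>(r / 3)\<^sup>2\<close>.\<close>
  define K where "K = ln n + n * L\<^sup>2"
  have K: "K \<ge> 0" using n L by (simp add: K_def)
  define k where "k = max 1 (9 * K / r\<^sup>2 + 1)"
  have k: "k \<ge> 1" "k > 0" by (auto simp: k_def)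
  have "9 * K / r\<^sup>2 < k" by (simp add: k_def)
  then have Kk: "K / k < (r / 3)\<^sup>2"
    using \<Omega>(3) k by (simp add: field_simps power_divide)
  define E where "E z = (\<Sum>i\<in>I. exp (- k * u i (z i)))" for z
  define P where "P y z = (\<Sum>i\<in>I. (z i - y) \<bullet> (z i - y))" for y and z :: "'i \<Rightarrow> 'a"
  define G where "G w = - (1 / k) * ln (E (snd w)) - k / 2 * P (fst w) (snd w) - \<phi> (fst w)
    - (fst w - x) \<bullet> (fst w - x)" for w :: "'a \<times> ('i \<Rightarrow> 'a)"
  have E_pos: "E z > 0" for z using I unfolding E_def by (intro sum_pos) auto
  \<comment> \<open>Coordinates outside \<open>I\<close> are confined to the ball too, so that
    \<open>D\<close> is a product of compact sets.\<close>
  define D where "D = cball x r \<times> (PiE UNIV (\<lambda>_::'i. cball x r))"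
  have D_iff: "(y, z) \<in> D \<longleftrightarrow> y \<in> cball x r \<and> (\<forall>i. z i \<in> cball x r)" for y z
    by (auto simp: D_def PiE_iff)
  have "compact D" unfolding D_def by (intro compact_Times compact_PiE_UNIV compact_cball)
  moreover have "(x, \<lambda>_. x) \<in> D" using \<Omega>(3) by (simp add: D_iff)
  then have "D \<noteq> {}" by blast
  moreover have "continuous_on D G"
  proof -
    have c1: "continuous_on D (\<lambda>w. snd w i)" for i
      by (rule continuous_on_product_then_coordinatewise) (intro continuous_intros)
    have "(\<lambda>w. snd w i) ` D \<subseteq> \<Omega>" for i
      using \<Omega>(2) D_iff by fastforce
    then have cu: "continuous_on D (\<lambda>w. u i (snd w i))" if "i \<in> I" for i
      using continuous_on_compose2[OF lipschitz_on_continuous_on[OF lip[OF that]] c1] by blast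
    have "continuous_on \<Omega> \<phi>"
      using \<phi> unfolding C1_gradient_def gderiv_def
      by (meson continuous_at_imp_continuous_on has_derivative_continuous)
    then have "continuous_on D (\<lambda>w. \<phi> (fst w))"
      by (rule continuous_on_compose2) (use \<Omega>(2) in \<open>auto intro!: continuous_intros simp: D_def\<close>)
    then show ?thesis
      using E_pos unfolding G_def E_def P_def
      by (intro continuous_intros c1 cu) (auto simp: less_imp_neq[symmetric])
  qed
  ultimately obtain w where w: "w \<in> D" "\<And>w'. w' \<in> D \<Longrightarrow> G w' \<le> G w"
    using continuous_attains_sup by metis
  obtain y z where wyz: "w = (y, z)" by (cases w)
  have yz: "y \<in> cball x r" "\<And>i. z i \<in> cball x r" using w(1) unfolding wyz D_iff by auto
  have in\<Omega>: "y \<in> \<Omega>" "\<And>i. z i \<in> \<Omega>" using yz \<Omega>(2) by auto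
  \<comment> \<open>The competitor is the point with all variables equal to \<open>x\<close>: both
    penalties vanish there, and only the soft minimum loses something.\<close>
  have "c - ln n / k - \<phi> x \<le> G (x, \<lambda>_. x)"
  proof -
    have "(\<lambda>i. u i x) ` I = {c}" using eq I by auto
    then show ?thesis
      using softmin_bounds(2)[OF I k(2), of "\<lambda>i. u i x"]
      by (simp add: G_def P_def E_def n_def)
  qed
  also have "\<dots> \<le> G (y, z)" using w \<open>(x, \<lambda>_. x) \<in> D\<close> wyz by blast
  also have "\<dots> \<le> Min ((\<lambda>i. u i (z i)) ` I) - k / 2 * P y z - \<phi> y - (norm (y - x))\<^sup>2"
    using softmin_bounds(1)[OF I k(2), of "\<lambda>i. u i (z i)"]
    by (simp add: G_def E_def power2_norm_eq_inner)
  \<comment> \<open>Moving every \<open>z i\<close> back to \<open>y\<close> costs Lipschitz terms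
    but makes the hypothesis on the minimum applicable at \<open>y\<close>.\<close>
  also have "\<dots> \<le> Min ((\<lambda>i. u i y) ` I) + L * (\<Sum>i\<in>I. norm (z i - y)) - k / 2 * P y z
      - \<phi> y - (norm (y - x))\<^sup>2"
  proof -
    have "Min ((\<lambda>i. u i (z i)) ` I) - L * (\<Sum>i\<in>I. norm (z i - y)) \<le> u j y" if j: "j \<in> I" for j
    proof -
      have "Min ((\<lambda>i. u i (z i)) ` I) \<le> u j (z j)" using I j by simp
      also have "u j (z j) \<le> u j y + L * norm (z j - y)"
        using lipschitz_on_normD[OF lip[OF j] in\<Omega>(2)[of j] in\<Omega>(1)] by (simp add: abs_le_iff)
      also have "L * norm (z j - y) \<le> L * (\<Sum>i\<in>I. norm (z i - y))"
        using I j L by (intro mult_left_mono member_le_sum) auto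
      finally show ?thesis by simp
    qed
    then have "Min ((\<lambda>i. u i (z i)) ` I) - L * (\<Sum>i\<in>I. norm (z i - y)) \<le> Min ((\<lambda>i. u i y) ` I)"
      using I by simp
    then show ?thesis by simp
  qed
  also have "\<dots> \<le> c - \<phi> x + L * (\<Sum>i\<in>I. norm (z i - y)) - k / 2 * P y z - (norm (y - x))\<^sup>2"
    using max[OF yz(1)] by simp
  \<comment> \<open>Young's inequality: half of the penalty absorbs the Lipschitz terms, and
    \<open>k / 4 * P y z\<close> remains.\<close>
  also have "L * (\<Sum>i\<in>I. norm (z i - y)) \<le> k / 4 * P y z + n * L\<^sup>2 / k"
  proof -
    have "L * norm (z i - y) \<le> k / 4 * ((z i - y) \<bullet> (z i - y)) + L\<^sup>2 / k" for i
    proof -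
      let ?s = "norm (z i - y)"
      have "0 \<le> (k * ?s - 2 * L)\<^sup>2 / (4 * k)" using k by simp
      also have "\<dots> = k / 4 * ?s\<^sup>2 + L\<^sup>2 / k - L * ?s"
        using k by (simp add: power2_eq_square field_simps)
      finally show ?thesis by (simp add: power2_norm_eq_inner)
    qed
    then have "(\<Sum>i\<in>I. L * norm (z i - y)) \<le> (\<Sum>i\<in>I. k / 4 * ((z i - y) \<bullet> (z i - y)) + L\<^sup>2 / k)"
      by (rule sum_mono)
    then show ?thesis by (simp add: sum.distrib sum_distrib_left P_def n_def)
  qed
  finally have main: "(norm (y - x))\<^sup>2 + k / 4 * P y z \<le> K / k"
    by (simp add: K_def add_divide_distrib)
  have P0: "P y z \<ge> 0" by (auto simp: P_def intro: sum_nonneg)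
  then have "(norm (y - x))\<^sup>2 < (r / 3)\<^sup>2"
    using main Kk k mult_nonneg_nonneg[of "k / 4" "P y z"] by linarith
  then have yx: "norm (y - x) < r / 3" using \<Omega>(3) by (rule_tac power2_less_imp_less) auto
  \<comment> \<open>\<open>y\<close> is within \<open>r / 3\<close> of \<open>x\<close> and
    \<open>z i\<close> within \<open>2 * r / 3\<close> of \<open>y\<close>, so the maximiser is
    interior in \<open>y\<close> and in each \<open>z i\<close> with \<open>i\<close> in
    \<open>I\<close>, and first-order conditions hold there.\<close>
  have zx: "norm (z i - x) < r" if i: "i \<in> I" for i
  proof -
    have "(norm (z i - y))\<^sup>2 \<le> P y z"
      unfolding P_def power2_norm_eq_inner using I i by (intro member_le_sum) auto
    also have "P y z \<le> k * P y z" using P0 k by (simp add: mult_le_cancel_right1)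
    also have "\<dots> \<le> 4 * (K / k)" using main zero_le_power2[of "norm (y - x)"] by linarith
    also have "\<dots> < 4 * (r / 3)\<^sup>2" using Kk by simp
    finally have "(norm (z i - y))\<^sup>2 < (2 * (r / 3))\<^sup>2" by (simp add: power2_eq_square)
    then have "norm (z i - y) < 2 * (r / 3)" using \<Omega>(3) by (rule_tac power2_less_imp_less) auto
    then show ?thesis using yx norm_triangle_ineq[of "z i - y" "y - x"] by simp
  qed
  \<comment> \<open>\<open>\<sigma> i\<close> is the partial derivative of the soft minimum in its
    \<open>i\<close>-th value, and \<open>p i\<close> is what stationarity in \<open>z i\<close>
    prescribes: \<open>\<sigma> i *\<^sub>R p i = k *\<^sub>R (z i - y)\<close>.\<close>
  define \<sigma> where "\<sigma> i = exp (- k * u i (z i)) / E z" for i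
  define p where "p i = (1 / \<sigma> i) *\<^sub>R (k *\<^sub>R (z i - y))" for i
  have \<sigma>: "0 < \<sigma> i" for i using E_pos by (simp add: \<sigma>_def)
  show thesis
  proof
    show "y \<in> ball x r" using yx \<Omega>(3) by (simp add: dist_norm norm_minus_commute)
    show "z i \<in> ball x r" if "i \<in> I" for i
      using zx[OF that] by (simp add: dist_norm norm_minus_commute)
    show "0 < \<sigma> i" for i by (rule \<sigma>)
    show "sum \<sigma> I = 1"
      using E_pos[of z] unfolding \<sigma>_def sum_divide_distrib[symmetric] E_def by simp
    show "p i \<in> frechet_superdiff \<Omega> (u i) (z i)" if i: "i \<in> I" for i
    proof -
      \<comment> \<open>With the other coordinates frozen, \<open>F\<close> is the soft minimum as a
        function of the \<open>i\<close>-th value and \<open>q\<close> is the \<open>i\<close>-th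
        penalty.\<close>
      define e where "e = (\<Sum>j\<in>I - {i}. exp (- k * u j (z j)))"
      have Eupd: "E (z(i := t)) = exp (- k * u i t) + e" for t
        using I i by (simp add: E_def e_def sum.remove)
      have Pupd: "P y (z(i := t)) = (t - y) \<bullet> (t - y) + (\<Sum>j\<in>I - {i}. (z j - y) \<bullet> (z j - y))" for t
        using I i by (simp add: P_def sum.remove)
      have Ez: "E z = exp (- k * u i (z i)) + e" using Eupd[of "z i"] by simp
      have e: "e \<ge> 0" by (simp add: e_def sum_nonneg)
      define F where "F t = - (1 / k) * ln (exp (- k * t) + e)" for t
      define q where "q t = k / 2 * ((t - y) \<bullet> (t - y))" for t :: 'a
      have "(F has_real_derivative \<sigma> i) (at (u i (z i)))"
        unfolding F_def \<sigma>_def Ez using k e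
        by (auto intro!: derivative_eq_intros simp: add_pos_nonneg)
      moreover have "GDERIV q (z i) :> k *\<^sub>R (z i - y)"
        unfolding gderiv_def q_def
        by (auto intro!: derivative_eq_intros simp: inner_commute algebra_simps)
      moreover have "\<forall>\<^sub>F t in nhds (z i). F (u i t) - q t \<le> F (u i (z i)) - q (z i)"
      proof -
        have "z i \<in> ball x r" using zx[OF i] by (simp add: dist_norm norm_minus_commute)
        then have "\<forall>\<^sub>F t in nhds (z i). t \<in> ball x r" by (intro eventually_nhds_in_open) auto
        then show ?thesis
        proof eventually_elim
          case (elim t)
          then have "(y, z(i := t)) \<in> D" using yz by (simp add: D_iff)
          from w(2)[OF this] have "G (y, z(i := t)) \<le> G (y, z(i := z i))" by (simp add: wyz)
          then show ?case unfolding G_def fst_conv snd_conv Eupd Pupd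
            by (simp add: F_def q_def distrib_left)
        qed
      qed
      ultimately show ?thesis
        unfolding p_def using \<Omega>(1) in\<Omega>(2) lip[OF i] \<sigma> by (intro frechet_superdiff_of_max)
    qed
    have "(\<Sum>i\<in>I. \<sigma> i *\<^sub>R p i) = (\<Sum>i\<in>I. k *\<^sub>R (z i - y))"
      using \<sigma> by (intro sum.cong) (auto simp: p_def less_imp_neq[symmetric])
    moreover have "(\<Sum>i\<in>I. k *\<^sub>R (z i - y)) - D\<phi> y - 2 *\<^sub>R (y - x) = 0" (is "?v = 0")
    proof -
      \<comment> \<open>\<open>Q\<close> is the part of \<open>G\<close> that depends on
        \<open>y\<close>; its gradient at the interior maximiser is \<open>?v\<close>.\<close>
      define Q where "Q t = - (k / 2 * P t z) - \<phi> t - (t - x) \<bullet> (t - x)" for t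
      have "(\<phi> has_derivative (\<lambda>h. h \<bullet> D\<phi> y)) (at y)"
        using \<phi> in\<Omega>(1) by (simp add: C1_gradient_def gderiv_def)
      then have "(Q has_derivative (\<lambda>h. h \<bullet> ?v)) (at y)"
        unfolding Q_def P_def
        by (auto intro!: derivative_eq_intros
            simp: fun_eq_iff inner_diff_right inner_diff_left inner_sum_right inner_commute
              sum_distrib_left algebra_simps sum.distrib sum_subtractf sum_negf)
      moreover have "Q t \<le> Q y" if "t \<in> ball x r" for t
      proof -
        have "(t, z) \<in> D" using that yz by (simp add: D_iff)
        from w(2)[OF this] show ?thesis unfolding wyz G_def Q_def by simp
      qed
      ultimately have "(\<lambda>h. h \<bullet> ?v) = (\<lambda>h. 0)"
        using \<open>y \<in> ball x r\<close> by (intro differential_zero_maxmin[of y "ball x r" Q]) auto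
      then have "?v \<bullet> ?v = 0" by metis
      then show ?thesis by simp
    qed
    ultimately show "(\<Sum>i\<in>I. \<sigma> i *\<^sub>R p i) = D\<phi> y + 2 *\<^sub>R (y - x)" by (simp add: algebra_simps)
  qed
qed

text \<open>The balls of the preceding lemma shrink to \<open>x\<close>. Weights and supergradients
  stay bounded, so a subsequence converges; \<open>2 *\<^sub>R (y - x)\<close> vanishes in the
  limit, and positive weights become nonnegative ones.\<close>

lemma superdiff_Min_convex_combination:
  fixes u :: "'i::countable \<Rightarrow> 'a::euclidean_space \<Rightarrow> real"
  assumes "open \<Omega>" "x \<in> \<Omega>" "finite I" "I \<noteq> {}"
    and lip: "\<And>i. i \<in> I \<Longrightarrow> L-lipschitz_on \<Omega> (u i)"
    and eq: "\<And>i. i \<in> I \<Longrightarrow> u i x = c"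
    and \<phi>: "C1_gradient \<Omega> \<phi> D\<phi>"
    and max: "\<forall>\<^sub>F y in nhds x. Min ((\<lambda>i. u i y) ` I) - \<phi> y \<le> c - \<phi> x"
  obtains \<sigma> p where "\<And>i. i \<in> I \<Longrightarrow> 0 \<le> \<sigma> i" and "sum \<sigma> I = 1"
    and "\<And>i. i \<in> I \<Longrightarrow> p i \<in> limiting_superdiff \<Omega> (u i) x"
    and "D\<phi> x = (\<Sum>i\<in>I. \<sigma> i *\<^sub>R p i)"
proof -
  have "\<forall>\<^sub>F y in nhds x. y \<in> \<Omega> \<and> Min ((\<lambda>i. u i y) ` I) - \<phi> y \<le> c - \<phi> x"
    using eventually_nhds_in_open[OF assms(1,2)] max by (rule eventually_conj)
  then obtain d where d: "d > 0"
    "\<And>y. dist y x < d \<Longrightarrow> y \<in> \<Omega> \<and> Min ((\<lambda>i. u i y) ` I) - \<phi> y \<le> c - \<phi> x"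
    unfolding eventually_nhds_metric by blast
  \<comment> \<open>The shift by 2 gives \<open>R n < d\<close> already for \<open>n = 0\<close>, so
    the closed balls stay where the local hypothesis holds.\<close>
  define R where "R n = d / real (n + 2)" for n
  have R: "0 < R n" "R n < d" for n
    using d(1) by (auto simp: R_def divide_less_eq)
  have R0: "R \<longlonglongrightarrow> 0"
    unfolding R_def by real_asymp
  define approx where "approx n y z \<sigma> p \<longleftrightarrow> y \<in> ball x (R n) \<and>
    (\<forall>i\<in>I. z i \<in> ball x (R n) \<and> 0 < \<sigma> i \<and> p i \<in> frechet_superdiff \<Omega> (u i) (z i)) \<and>
    sum \<sigma> I = 1 \<and> (\<Sum>i\<in>I. \<sigma> i *\<^sub>R p i) = D\<phi> y + 2 *\<^sub>R (y - x)" for n y z \<sigma> p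
  have "\<exists>y z \<sigma> p. approx n y z \<sigma> p" for n
  proof -
    have sub: "dist y x < d" if "y \<in> cball x (R n)" for y
      using that R(2)[of n] by (simp add: dist_commute)
    have cball: "cball x (R n) \<subseteq> \<Omega>" using sub d(2) by blast
    have le: "Min ((\<lambda>i. u i y) ` I) - \<phi> y \<le> c - \<phi> x" if "y \<in> cball x (R n)" for y
      using sub[OF that] d(2) by blast
    show ?thesis
      unfolding approx_def
      by (rule approximate_superdiff_Min[OF assms(1) cball R(1) assms(3,4) lip eq \<phi> le])
        (assumption | blast)+
  qed
  then obtain Y Z S P where "\<And>n. approx n (Y n) (Z n) (S n) (P n)" by metis
  then have Y: "\<And>n. Y n \<in> ball x (R n)"
    and Z: "\<And>n i. i \<in> I \<Longrightarrow> Z n i \<in> ball x (R n)"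
    and S: "\<And>n i. i \<in> I \<Longrightarrow> 0 < S n i" "\<And>n. sum (S n) I = 1"
    and P: "\<And>n i. i \<in> I \<Longrightarrow> P n i \<in> frechet_superdiff \<Omega> (u i) (Z n i)"
    and SP: "\<And>n. (\<Sum>i\<in>I. S n i *\<^sub>R P n i) = D\<phi> (Y n) + 2 *\<^sub>R (Y n - x)"
    unfolding approx_def by blast+
  have lim: "W \<longlonglongrightarrow> x" if "\<And>n. W n \<in> ball x (R n)" for W
    using that by (intro metric_tendsto_imp_tendsto[OF R0])
      (auto intro!: always_eventually simp: dist_commute less_imp_le abs_of_pos R)
  have Z\<Omega>: "Z n i \<in> \<Omega>" if "i \<in> I" for n i
    using Z[OF that, of n] R(2)[of n] d(2) by (simp add: dist_commute)
  \<comment> \<open>Extension by 0 off \<open>I\<close> puts the weights and supergradients into a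
    compact product over the whole index type.\<close>
  define S' where "S' n i = (if i \<in> I then S n i else 0)" for n i
  define P' where "P' n i = (if i \<in> I then P n i else 0)" for n i
  obtain i0 where i0: "i0 \<in> I" using assms(4) by blast
  have L: "0 \<le> L" using lipschitz_on_nonneg[OF lip[OF i0]] .
  define K where "K = PiE UNIV (\<lambda>_::'i. {0..1::real}) \<times> PiE UNIV (\<lambda>_::'i. cball (0::'a) L)"
  have "compact K" unfolding K_def by (intro compact_Times compact_PiE_UNIV) auto
  \<comment> \<open>Countability of the index type makes the product topology first
    countable.\<close>
  then have "seq_compact K" by (rule compact_imp_seq_compact)
  moreover have "\<forall>n. (S' n, P' n) \<in> K"
  proof
    fix n
    have "S n i \<le> 1" if "i \<in> I" for i
      using member_le_sum[of i I "S n"] S(1)[of _ n] S(2)[of n] that assms(3) by (auto simp: less_imp_le)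
    moreover have "norm (P n i) \<le> L" if "i \<in> I" for i
      using norm_frechet_superdiff_le[OF assms(1) Z\<Omega>[OF that] lip[OF that] P[OF that]] .
    ultimately show "(S' n, P' n) \<in> K"
      using S(1)[of _ n] L by (auto simp: K_def S'_def P'_def less_imp_le)
  qed
  ultimately obtain l r where l: "l \<in> K" and r: "strict_mono (r :: nat \<Rightarrow> nat)"
    and lr: "((\<lambda>n. (S' n, P' n)) \<circ> r) \<longlonglongrightarrow> l"
    by (rule seq_compactE)
  define \<sigma> p where "\<sigma> = fst l" and "p = snd l"
  have coord: "(\<lambda>n. W n i) \<longlonglongrightarrow> w i" if "W \<longlonglongrightarrow> w" for W and w :: "'i \<Rightarrow> 'b::topological_space" and i
    using continuous_on_tendsto_compose[OF continuous_on_product_coordinates[of i] that] by simp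
  have \<sigma>_lim: "(\<lambda>n. S' (r n) i) \<longlonglongrightarrow> \<sigma> i" for i
    using coord[OF tendsto_fst[OF lr]] by (simp add: \<sigma>_def)
  have p_lim: "(\<lambda>n. P' (r n) i) \<longlonglongrightarrow> p i" for i
    using coord[OF tendsto_snd[OF lr]] by (simp add: p_def)
  show thesis
  proof
    show "0 \<le> \<sigma> i" for i using l by (auto simp: K_def \<sigma>_def)
    have "(\<lambda>n. \<Sum>i\<in>I. S' (r n) i) \<longlonglongrightarrow> sum \<sigma> I" by (intro tendsto_sum \<sigma>_lim)
    moreover have "(\<Sum>i\<in>I. S' (r n) i) = 1" for n using S(2)[of "r n"] by (simp add: S'_def)
    ultimately show "sum \<sigma> I = 1" by (simp add: LIMSEQ_const_iff)
    show "p i \<in> limiting_superdiff \<Omega> (u i) x" if i: "i \<in> I" for i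
    proof -
      have "(\<lambda>n. Z (r n) i) \<longlonglongrightarrow> x"
        using LIMSEQ_subseq_LIMSEQ[OF lim[OF Z[OF i]] r] by (simp add: o_def)
      moreover have "(\<lambda>n. P (r n) i) \<longlonglongrightarrow> p i" using p_lim[of i] i by (simp add: P'_def)
      ultimately show ?thesis
        using Z\<Omega>[OF i] P[OF i] unfolding limiting_superdiff_def mem_Collect_eq
        by (intro exI[of _ "\<lambda>n. Z (r n) i"] exI[of _ "\<lambda>n. P (r n) i"]) simp
    qed
    have Yr: "(\<lambda>n. Y (r n)) \<longlonglongrightarrow> x"
      using LIMSEQ_subseq_LIMSEQ[OF lim[OF Y] r] by (simp add: o_def)
    moreover have "isCont D\<phi> x"
      using \<phi> assms(1,2) by (auto simp: C1_gradient_def continuous_on_eq_continuous_at)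
    ultimately have "(\<lambda>n. D\<phi> (Y (r n)) + 2 *\<^sub>R (Y (r n) - x)) \<longlonglongrightarrow> D\<phi> x + 2 *\<^sub>R (x - x)"
      by (intro tendsto_intros isCont_tendsto_compose[of x D\<phi>])
    moreover have "(\<lambda>n. \<Sum>i\<in>I. S' (r n) i *\<^sub>R P' (r n) i) \<longlonglongrightarrow> (\<Sum>i\<in>I. \<sigma> i *\<^sub>R p i)"
      by (intro tendsto_intros \<sigma>_lim p_lim)
    moreover have "(\<Sum>i\<in>I. S' (r n) i *\<^sub>R P' (r n) i) = D\<phi> (Y (r n)) + 2 *\<^sub>R (Y (r n) - x)" for n
      using SP[of "r n"] by (simp add: S'_def P'_def)
    ultimately show "D\<phi> x = (\<Sum>i\<in>I. \<sigma> i *\<^sub>R p i)"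
      using LIMSEQ_unique by fastforce
  qed
qed

section \<open>The minimum of the auxiliary solutions as a solution of the original problem\<close>

lemma min_value_le: "i \<in> {1..m} \<Longrightarrow> min_value m vi x \<le> vi i x"
  by (simp add: min_value_def)

lemma min_value_attained:
  assumes "m \<ge> 1"
  obtains i where "i \<in> {1..m}" "vi i x = min_value m vi x"
proof -
  have "min_value m vi x \<in> (\<lambda>i. vi i x) ` {1..m}"
    unfolding min_value_def using assms by (intro Min_in) auto
  then show thesis using that by fastforce
qed

text \<open>An index attaining the minimum at \<open>y\<close> bounds the minimum at
  \<open>x\<close> from above; exchanging the points gives the other inequality.\<close>

lemma lipschitz_on_min_value:
  assumes "m \<ge> 1" and lip: "\<And>i. i \<in> {1..m} \<Longrightarrow> M-lipschitz_on S (vi i)"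
  shows "M-lipschitz_on S (min_value m vi)"
proof (rule lipschitz_onI)
  show "0 \<le> M" using lipschitz_on_nonneg[OF lip[of 1]] assms(1) by simp
  have *: "min_value m vi x - min_value m vi y \<le> M * dist x y" if xy: "x \<in> S" "y \<in> S" for x y
  proof -
    obtain i where i: "i \<in> {1..m}" "vi i y = min_value m vi y"
      using min_value_attained[OF assms(1)] .
    have "\<bar>vi i x - vi i y\<bar> \<le> M * dist x y"
      using lipschitz_onD[OF lip[OF i(1)] xy] by (simp add: dist_real_def)
    then show ?thesis using min_value_le[OF i(1), of vi x] i(2) by linarith
  qed
  fix x y assume "x \<in> S" "y \<in> S"
  then show "dist (min_value m vi x) (min_value m vi y) \<le> M * dist x y"
    using *[of x y] *[of y x] by (simp add: dist_real_def dist_commute abs_le_iff)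
qed

text \<open>At \<open>x\<close> the inactive functions exceed an active one strictly, and by
  continuity they still do nearby. Hence test function conditions at \<open>x\<close> concern only
  functions with the same value at \<open>x\<close>.\<close>

lemma eventually_min_value_eq_Min_active:
  assumes "m \<ge> 1" and cont: "\<And>i. i \<in> {1..m} \<Longrightarrow> isCont (vi i) x"
  shows "\<forall>\<^sub>F y in nhds x. min_value m vi y = Min ((\<lambda>i. vi i y) ` active m vi x)"
proof -
  obtain j where j: "j \<in> {1..m}" "vi j x = min_value m vi x"
    using min_value_attained[OF assms(1)] .
  have lim: "(vi i \<longlongrightarrow> vi i x) (nhds x)" if "i \<in> {1..m}" for i
    using cont[OF that] by (simp add: isCont_def tendsto_at_iff_tendsto_nhds)
  have "\<forall>\<^sub>F y in nhds x. i \<notin> active m vi x \<longrightarrow> vi j y < vi i y" if i: "i \<in> {1..m}" for i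
  proof (cases "i \<in> active m vi x")
    case False
    then have "vi j x < vi i x" using i j min_value_le[OF i, of vi x] by (auto simp: active_def)
    then have "\<forall>\<^sub>F y in nhds x. 0 < vi i y - vi j y"
      by (intro order_tendstoD(1)[OF tendsto_diff[OF lim[OF i] lim[OF j(1)]]]) simp
    then show ?thesis by eventually_elim simp
  qed simp
  then have "\<forall>\<^sub>F y in nhds x. \<forall>i\<in>{1..m}. i \<notin> active m vi x \<longrightarrow> vi j y < vi i y"
    by (intro eventually_ball_finite) auto
  then show ?thesis
  proof eventually_elim
    case (elim y)
    have act: "active m vi x \<subseteq> {1..m}" "finite (active m vi x)" by (auto simp: active_def)
    obtain k where k: "k \<in> {1..m}" "vi k y = min_value m vi y"
      using min_value_attained[OF assms(1)] .
    \<comment> \<open>Otherwise \<open>vi j y < vi k y\<close>, against the minimality of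
      \<open>k\<close> at \<open>y\<close>.\<close>
    then have "k \<in> active m vi x" using elim min_value_le[OF j(1), of vi y] by fastforce
    then have "Min ((\<lambda>i. vi i y) ` active m vi x) = vi k y"
    proof (intro Min_eqI)
      show "vi k y \<in> (\<lambda>i. vi i y) ` active m vi x" using \<open>k \<in> active m vi x\<close> by blast
    qed (use act k(2) min_value_le[of _ m vi y] in auto)
    then show ?case using k by simp
  qed
qed

lemma viscosity_solution_min_value:
  fixes vi :: "nat \<Rightarrow> 'a::euclidean_space \<Rightarrow> real"
  assumes "open \<Omega>" "m \<ge> 1"
    and lip: "\<And>i. i \<in> {1..m} \<Longrightarrow> M-lipschitz_on \<Omega> (vi i)"
    and sol: "\<And>i. i \<in> {1..m} \<Longrightarrow> viscosity_solution \<Omega> lam H (vi i)"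
    and H2: "H2 \<Omega> lam H m vi"
  shows "viscosity_solution \<Omega> lam H (min_value m vi)"
  unfolding viscosity_solution_def
proof (intro conjI allI impI)
  show "continuous_on \<Omega> (min_value m vi)"
    using lipschitz_on_min_value[OF assms(2) lip] by (rule lipschitz_on_continuous_on)
next
  fix \<phi> D\<phi> x
  assume "C1_gradient \<Omega> \<phi> D\<phi> \<and> x \<in> \<Omega> \<and>
    (\<forall>\<^sub>F y in nhds x. min_value m vi y - \<phi> y \<ge> min_value m vi x - \<phi> x)"
  then have \<phi>: "C1_gradient \<Omega> \<phi> D\<phi>" "x \<in> \<Omega>"
    and min: "\<forall>\<^sub>F y in nhds x. min_value m vi y - \<phi> y \<ge> min_value m vi x - \<phi> x" by auto
  \<comment> \<open>Supersolution: the minimum lies below \<open>vi i\<close> with equality at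
    \<open>x\<close>, so a function touching it from below touches \<open>vi i\<close> from
    below.\<close>
  obtain i where i: "i \<in> {1..m}" "vi i x = min_value m vi x"
    using min_value_attained[OF assms(2)] .
  from min have "\<forall>\<^sub>F y in nhds x. vi i y - \<phi> y \<ge> vi i x - \<phi> x"
  proof eventually_elim
    case (elim y)
    then show ?case using min_value_le[OF i(1), of vi y] i(2) by linarith
  qed
  then have "ereal (lam * vi i x) + H x (D\<phi> x) \<ge> 0"
    using sol[OF i(1)] \<phi> unfolding viscosity_solution_def by blast
  then show "ereal (lam * min_value m vi x) + H x (D\<phi> x) \<ge> 0" by (simp add: i(2))
next
  fix \<phi> D\<phi> x
  assume "C1_gradient \<Omega> \<phi> D\<phi> \<and> x \<in> \<Omega> \<and>
    (\<forall>\<^sub>F y in nhds x. min_value m vi y - \<phi> y \<le> min_value m vi x - \<phi> x)"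
  then have \<phi>: "C1_gradient \<Omega> \<phi> D\<phi>" "x \<in> \<Omega>"
    and max: "\<forall>\<^sub>F y in nhds x. min_value m vi y - \<phi> y \<le> min_value m vi x - \<phi> x" by auto
  let ?I = "active m vi x"
  have fin: "finite ?I" and act: "?I \<subseteq> {1..m}" and eq: "\<And>i. i \<in> ?I \<Longrightarrow> vi i x = min_value m vi x"
    by (auto simp: active_def)
  obtain j where "j \<in> {1..m}" "vi j x = min_value m vi x"
    using min_value_attained[OF assms(2)] .
  then have ne: "?I \<noteq> {}" by (auto simp: active_def)
  have "isCont (vi i) x" if "i \<in> {1..m}" for i
    using lipschitz_on_continuous_on[OF lip[OF that]] \<phi>(2) assms(1)
    by (simp add: continuous_on_eq_continuous_at)
  then have "\<forall>\<^sub>F y in nhds x. min_value m vi y = Min ((\<lambda>i. vi i y) ` ?I)"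
    by (rule eventually_min_value_eq_Min_active[OF assms(2)])
  then have max': "\<forall>\<^sub>F y in nhds x. Min ((\<lambda>i. vi i y) ` ?I) - \<phi> y \<le> min_value m vi x - \<phi> x"
    using max by eventually_elim simp
  \<comment> \<open>\<open>H2\<close> covers points with several active indices; where only one is
    active, the minimum agrees locally with that \<open>vi i\<close>, whose own subsolution property
    applies.\<close>
  show "ereal (lam * min_value m vi x) + H x (D\<phi> x) \<le> 0"
  proof (cases "card ?I > 1")
    case True
    obtain \<sigma> p where "\<And>i. i \<in> ?I \<Longrightarrow> 0 \<le> \<sigma> i" "sum \<sigma> ?I = 1"
      "\<And>i. i \<in> ?I \<Longrightarrow> p i \<in> limiting_superdiff \<Omega> (vi i) x"
      "D\<phi> x = (\<Sum>i\<in>?I. \<sigma> i *\<^sub>R p i)"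
      using superdiff_Min_convex_combination[OF assms(1) \<phi>(2) fin ne lip eq \<phi>(1) max'] act by blast
    then show ?thesis using H2 \<phi>(2) True unfolding H2_def by simp
  next
    case False
    moreover have "card ?I > 0" using fin ne by (simp add: card_gt_0_iff)
    ultimately have "card ?I = 1" by linarith
    then obtain i where i: "?I = {i}" using card_1_singletonE by blast
    then have "\<forall>\<^sub>F y in nhds x. vi i y - \<phi> y \<le> vi i x - \<phi> x" using max' eq[of i] by simp
    moreover have "i \<in> {1..m}" using i act by blast
    ultimately have "ereal (lam * vi i x) + H x (D\<phi> x) \<le> 0"
      using sol[of i] \<phi> unfolding viscosity_solution_def by blast
    then show ?thesis using eq[of i] i by simp
  qed
qed

text \<open>The boundary datum is right because every \<open>gi k\<close> is at least
  \<open>g\<close> on \<open>\<Gamma>\<close>, and the pieces \<open>\<Gamma>i k\<close> cover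
  \<open>\<Gamma>\<close>, which gives equality for some index at each point.\<close>

lemma lipschitz_solution_min_value:
  fixes vi :: "nat \<Rightarrow> 'a::euclidean_space \<Rightarrow> real"
  assumes "open \<Omega>" "m \<ge> 1" and H2: "H2 \<Omega> lam H m vi"
    and \<Gamma>: "\<Gamma> = (\<Union>k\<in>{1..m}. \<Gamma>i k)"
    and g_eq: "\<And>k x. k \<in> {1..m} \<Longrightarrow> x \<in> \<Gamma>i k \<Longrightarrow> gi k x = g x"
    and g_gt: "\<And>k x. k \<in> {1..m} \<Longrightarrow> x \<in> \<Gamma> - \<Gamma>i k \<Longrightarrow> gi k x > g x"
    and sol: "\<And>k. k \<in> {1..m} \<Longrightarrow> lipschitz_solution \<Omega> \<Gamma> lam H (gi k) (vi k)"
    and lip: "\<And>k. k \<in> {1..m} \<Longrightarrow> M-lipschitz_on (closure \<Omega>) (vi k)"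
  shows "lipschitz_solution \<Omega> \<Gamma> lam H g (min_value m vi)"
  unfolding lipschitz_solution_def
proof (intro conjI ballI)
  show "\<exists>L. L-lipschitz_on (closure \<Omega>) (min_value m vi)"
    by (intro exI[of _ M] lipschitz_on_min_value assms(2) lip)
  show "viscosity_solution \<Omega> lam H (min_value m vi)"
    using sol H2 assms(1,2) lipschitz_on_subset[OF lip closure_subset]
    by (intro viscosity_solution_min_value) (auto simp: lipschitz_solution_def)
next
  fix x assume x: "x \<in> \<Gamma>"
  then obtain k where k: "k \<in> {1..m}" "x \<in> \<Gamma>i k" using \<Gamma> by blast
  have vg: "vi j x = gi j x" if "j \<in> {1..m}" for j
    using sol[OF that] x by (simp add: lipschitz_solution_def)
  have "g x \<le> vi j x" if j: "j \<in> {1..m}" for j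
    using vg[OF j] g_eq[OF j, of x] g_gt[OF j, of x] x by (cases "x \<in> \<Gamma>i j") auto
  moreover have "vi k x = g x" using vg[OF k(1)] g_eq[OF k] by simp
  ultimately show "min_value m vi x = g x"
    unfolding min_value_def using k(1) by (intro Min_eqI) force+
qed

section \<open>From the a priori error estimate to the bound at a node\<close>

lemma abs_diff_le_of_sup_error:
  assumes "x \<in> nodes \<T> \<inter> closure \<Omega>"
    and "sup_error \<Omega> \<T> w W \<le> ereal e" "sup_error \<Omega> \<T> w' W' \<le> ereal e'"
  shows "\<bar>W x - W' x\<bar> \<le> ereal (e + \<bar>w x - w' x\<bar> + e')"
proof -
  have "\<bar>ereal (w x) - W x\<bar> \<le> ereal e" "\<bar>ereal (w' x) - W' x\<bar> \<le> ereal e'"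
    using assms unfolding sup_error_def by (meson SUP_upper order_trans)+
  \<comment> \<open>A finite distance to the real numbers \<open>w x\<close> and \<open>w' x\<close>
    rules out infinite \<open>W x\<close> and \<open>W' x\<close>; what remains is the real triangle
    inequality.\<close>
  then show ?thesis by (cases "W x"; cases "W' x") auto
qed

theorem proposition3p1:
  fixes \<Omega> \<Gamma> :: "'a::euclidean_space set"
    and A :: "'b::euclidean_space set" and B :: "'c::euclidean_space set"
    and f :: "'a \<Rightarrow> 'b \<Rightarrow> 'c \<Rightarrow> 'a" and l :: "'a \<Rightarrow> 'b \<Rightarrow> 'c \<Rightarrow> ereal" and g :: "'a \<Rightarrow> real"
    and lam \<rho> C q :: real and m :: nat
    and \<Gamma>i :: "nat \<Rightarrow> 'a set" and gi :: "nat \<Rightarrow> 'a \<Rightarrow> real"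
    and v :: "'a \<Rightarrow> real" and vi :: "nat \<Rightarrow> 'a \<Rightarrow> real"
    and grids :: "'a set set set" and h :: "real \<Rightarrow> real"
    and V :: "'a set set \<Rightarrow> 'a \<Rightarrow> ereal" and Vi :: "'a set set \<Rightarrow> nat \<Rightarrow> 'a \<Rightarrow> ereal"
    and \<T> :: "'a set set" and x\<^sub>j d :: 'a and \<epsilon> :: real and i :: nat
  assumes "open \<Omega>"
    and "compact A" "A \<noteq> {}" "compact B" "B \<noteq> {}"
    and "0 \<le> lam"
    and "\<Gamma> \<subseteq> frontier \<Omega>" "hausdorff_dim \<Gamma> = real DIM('a) - 1"
    and "H0 \<Omega> A B f l g \<rho>"
    and "isaacs \<Omega> A B f l"
    and "\<And>x. x \<in> closure \<Omega> \<Longrightarrow> ereal (v x) = value_function \<Omega> A B f l g lam x"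
    and "unique_lipschitz_solution \<Omega> \<Gamma> lam (hamiltonian A B f l) g v"
    and "\<Gamma> = (\<Union>k\<in>{1..m}. \<Gamma>i k)"
    and "\<And>k. k \<in> {1..m} \<Longrightarrow> continuous_on \<Gamma> (gi k)"
    and "\<And>k x. k \<in> {1..m} \<Longrightarrow> x \<in> \<Gamma>i k \<Longrightarrow> gi k x = g x"
    and "\<And>k x. k \<in> {1..m} \<Longrightarrow> x \<in> \<Gamma> - \<Gamma>i k \<Longrightarrow> gi k x > g x"
    and "\<And>k. k \<in> {1..m} \<Longrightarrow> lipschitz_solution \<Omega> \<Gamma> lam (hamiltonian A B f l) (gi k) (vi k)"
    and "H2 \<Omega> lam (hamiltonian A B f l) m vi"
    and "\<And>\<S>. \<S> \<in> grids \<Longrightarrow> is_grid \<Omega> \<S>" "\<And>\<S>. \<S> \<in> grids \<Longrightarrow> h (mesh_size \<S>) > 0"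
    and
      "\<And>\<S>. \<S> \<in> grids \<Longrightarrow> scheme_solution \<Omega> A B f l lam \<S> (h (mesh_size \<S>)) g (V \<S>)"
      "\<And>\<S> k. \<S> \<in> grids \<Longrightarrow> k \<in> {1..m} \<Longrightarrow>
         scheme_solution \<Omega> A B f l lam \<S> (h (mesh_size \<S>)) (gi k) (Vi \<S> k)"
    and "C > 0" "q \<ge> 0"
      "\<And>\<S>. \<S> \<in> grids \<Longrightarrow> sup_error \<Omega> \<S> v (V \<S>) \<le> ereal (C * mesh_size \<S> powr q)"
      "\<And>\<S> k. \<S> \<in> grids \<Longrightarrow> k \<in> {1..m} \<Longrightarrow>
         sup_error \<Omega> \<S> (vi k) (Vi \<S> k) \<le> ereal (C * mesh_size \<S> powr q)"
    and "\<T> \<in> grids" "x\<^sub>j \<in> internal_nodes \<Omega> \<T>"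
    and "0 \<le> \<epsilon>" "\<epsilon> < mesh_size \<T>" "d \<in> cball 0 1"
    and "x\<^sub>j - \<epsilon> *\<^sub>R d \<in> \<Omega>"
    and "i \<in> {1..m}" "vi i (x\<^sub>j - \<epsilon> *\<^sub>R d) = v (x\<^sub>j - \<epsilon> *\<^sub>R d)"
  shows "\<bar>Vi \<T> i x\<^sub>j - V \<T> x\<^sub>j\<bar>
    \<le> ereal (2 * (C * mesh_size \<T> powr q
                + Max ((\<lambda>k. lip_const (closure \<Omega>) (vi k)) ` {1..m}) * mesh_size \<T>))"
proof -
  let ?M = "Max ((\<lambda>k. lip_const (closure \<Omega>) (vi k)) ` {1..m})" and ?e = "C * mesh_size \<T> powr q"
  let ?x = "x\<^sub>j - \<epsilon> *\<^sub>R d"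
  note \<Omega> = assms(1) and uniq = assms(12) and sol = assms(17) and xj = assms(28)
    and error = assms(25)[OF assms(27)] assms(26)[OF assms(27) assms(33)]
  have m: "m \<ge> 1" using assms(33) by simp
  have lip: "?M-lipschitz_on (closure \<Omega>) (vi k)" if k: "k \<in> {1..m}" for k
  proof -
    obtain L where "L-lipschitz_on (closure \<Omega>) (vi k)"
      using sol[OF k] by (auto simp: lipschitz_solution_def)
    then show ?thesis
      by (rule lipschitz_on_le[OF lipschitz_on_lip_const]) (use k in simp)
  qed
  \<comment> \<open>The minimum solves the problem for \<open>g\<close>, so uniqueness identifies it
    with \<open>v\<close> on the closure, and \<open>v\<close> inherits the constant
    \<open>?M\<close>.\<close>
  have "lipschitz_solution \<Omega> \<Gamma> lam (hamiltonian A B f l) g (min_value m vi)"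
    using \<Omega> m assms(18,13,15,16) sol lip by (rule lipschitz_solution_min_value)
  then have v: "v x = min_value m vi x" if "x \<in> closure \<Omega>" for x
    using uniq that by (simp add: unique_lipschitz_solution_def)
  have lip_v: "?M-lipschitz_on (closure \<Omega>) v"
    using lipschitz_on_min_value[OF m lip] v by (rule lipschitz_on_transform)
  have M: "0 \<le> ?M" using lip_v by (rule lipschitz_on_nonneg)
  have cl: "x\<^sub>j \<in> closure \<Omega>" "?x \<in> closure \<Omega>"
    using xj assms(32) closure_subset by (auto simp: internal_nodes_def)
  have "dist x\<^sub>j ?x = \<epsilon> * norm d" using assms(29) by (simp add: dist_norm)
  also have "\<dots> \<le> \<epsilon>" using assms(29,31) by (simp add: mult_left_le)
  finally have "dist x\<^sub>j ?x \<le> mesh_size \<T>" using assms(30) by simp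
  then have "?M * dist x\<^sub>j ?x \<le> ?M * mesh_size \<T>" using M by (rule mult_left_mono)
  \<comment> \<open>\<open>vi i\<close> and \<open>v\<close> agree at \<open>?x\<close>, so at the
    node they differ by at most two Lipschitz increments; hence the factor 2.\<close>
  then have diff: "\<bar>vi i x\<^sub>j - v x\<^sub>j\<bar> \<le> 2 * (?M * mesh_size \<T>)"
    using lipschitz_onD[OF lip[OF assms(33)] cl] lipschitz_onD[OF lip_v cl] assms(34)
    by (simp add: dist_real_def)
  have "\<bar>Vi \<T> i x\<^sub>j - V \<T> x\<^sub>j\<bar> \<le> ereal (?e + \<bar>vi i x\<^sub>j - v x\<^sub>j\<bar> + ?e)"
    using error xj cl by (intro abs_diff_le_of_sup_error) (auto simp: internal_nodes_def)
  also have "\<dots> \<le> ereal (2 * (?e + ?M * mesh_size \<T>))" using diff by simp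
  finally show ?thesis .
qed

end
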